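(* If $X\subseteq\mathbb{Z}^2\setminus\{O\}$ is an arbitrary finite step set, then $X$ has either the Finite Paths Property (FPP) or the Infinite Paths Property (IPP).
   Context: Write $O=(0,0)$. A step set is any subset $X$ of $\mathbb{Z}^2\setminus\{O\}$. $\mathcal{F}_X$ is the free monoid on $X$ (all finite words over $X$, including the empty word), $\mathcal{A}_X$ is the additive submonoid of $\mathbb{Z}^2$ generated by $X$, and $\alpha_X:\mathcal{F}_X\to\mathcal{A}_X$ is given by $\alpha_X(A_1\cdots A_k)=A_1+\cdots+A_k$. For $A\in\mathbb{Z}^2$, $\pi_X(A)$ is the (possibly infinite) number of words $w\in\mathcal{F}_X$ with $\alpha_X(w)=A$. $X$ has the FPP if $\pi_X(A)<\infty$ for all $A\in\mathcal{A}_X$, and the IPP if $\pi_X(A)=\infty$ for all $A\in\mathcal{A}_X$. *)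

theory Defs
  imports Main "HOL-Library.Product_Plus" "HOL-Library.Extended_Nat"
begin

type_synonym lattice_point = "int \<times> int"

abbreviation origin :: lattice_point where
  "origin \<equiv> (0, 0)"

definition step_set :: "lattice_point set \<Rightarrow> bool" where
  "step_set X \<longleftrightarrow> X \<subseteq> UNIV - {origin}"

text \<open>The free monoid on \<open>X\<close> is the set of words (lists) over \<open>X\<close> under concatenation.\<close>

definition free_monoid :: "lattice_point set \<Rightarrow> lattice_point list set" where
  "free_monoid X = lists X"

inductive_set additive_submonoid :: "lattice_point set \<Rightarrow> lattice_point set"
  for X :: "lattice_point set" where
  zero: "origin \<in> additive_submonoid X"
| gen: "A \<in> X \<Longrightarrow> A \<in> additive_submonoid X"
| add: "A \<in> additive_submonoid X \<Longrightarrow> B \<in> additive_submonoid X \<Longrightarrow> A + B \<in> additive_submonoid X"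

text \<open>The map \<open>\<alpha>\<^sub>X\<close> is the restriction to \<open>free_monoid X\<close> of the following total function,
  which does not depend on \<open>X\<close>.\<close>

definition endpoint :: "lattice_point list \<Rightarrow> lattice_point" where
  "endpoint w = sum_list w"

definition paths_to :: "lattice_point set \<Rightarrow> lattice_point \<Rightarrow> lattice_point list set" where
  "paths_to X A = {w \<in> free_monoid X. endpoint w = A}"

text \<open>The number \<open>\<pi>\<^sub>X(A)\<close>. The case distinction is needed because \<open>card\<close> is \<open>0\<close> on
  infinite sets.\<close>

definition num_paths :: "lattice_point set \<Rightarrow> lattice_point \<Rightarrow> enat" where
  "num_paths X A = (if finite (paths_to X A) then enat (card (paths_to X A)) else \<infinity>)"

definition FPP :: "lattice_point set \<Rightarrow> bool" where
  "FPP X \<longleftrightarrow> (\<forall>A \<in> additive_submonoid X. num_paths X A < \<infinity>)"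

definition IPP :: "lattice_point set \<Rightarrow> bool" where
  "IPP X \<longleftrightarrow> (\<forall>A \<in> additive_submonoid X. num_paths X A = \<infinity>)"

end

theory Submission
  imports Defs Complex_Main "HOL-Library.Multiset"
begin

text \<open>If some nonempty word over \<open>X\<close> sums to zero, prefixing its powers to any word with
  endpoint \<open>A\<close> yields infinitely many such words. Conversely, if infinitely many words have
  endpoint \<open>A\<close>, then they have infinitely many letter multisets, and by Dickson's lemma one of
  these multisets is properly contained in another; the difference is a nonempty multiset of
  steps summing to zero.\<close>

text \<open>Every sequence in a linear order has a monotone subsequence. If that one is decreasing,
  well-foundedness of \<open>nat\<close> makes it eventually constant, so a tail of it is also
  nondecreasing.\<close>

lemma ex_mono_subseq_nat:
  fixes s :: "nat \<Rightarrow> nat"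
  shows "\<exists>r :: nat \<Rightarrow> nat. strict_mono r \<and> mono (\<lambda>n. s (r n))"
proof -
  obtain r :: "nat \<Rightarrow> nat" where r: "strict_mono r" "monoseq (\<lambda>n. s (r n))"
    using seq_monosub[of s] by auto
  show ?thesis
  proof (cases "incseq (\<lambda>n. s (r n))")
    case True
    then show ?thesis using r(1) by blast
  next
    case False
    then have dec: "decseq (\<lambda>n. s (r n))"
      using r(2) by (simp add: monoseq_iff)
    \<comment> \<open>The least value is attained at index \<open>k\<close>; a decreasing sequence
      cannot change after that, so shifting by \<open>k\<close> leaves a constant one.\<close>
    obtain k where k: "\<And>n. s (r k) \<le> s (r n)"
      using ex_has_least_nat[of "\<lambda>_. True" 0 "\<lambda>n. s (r n)"] by auto
    have "s (r (n + k)) = s (r k)" for n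
      using decseqD[OF dec, of k "n + k"] k[of "n + k"] by simp
    then have "mono (\<lambda>n. s (r (n + k)))" by (simp add: mono_def)
    moreover have "strict_mono (\<lambda>n. r (n + k))"
      using r(1) by (simp add: strict_mono_def)
    ultimately show ?thesis by blast
  qed
qed

text \<open>One coordinate is treated at a time: thinning the sequence further for \<open>y\<close>
  preserves monotonicity in the coordinates already handled.\<close>

lemma ex_mono_subseq_pointwise:
  fixes f :: "nat \<Rightarrow> 'a \<Rightarrow> nat"
  assumes "finite X"
  shows "\<exists>r :: nat \<Rightarrow> nat. strict_mono r \<and> (\<forall>x\<in>X. mono (\<lambda>n. f (r n) x))"
  using assms
proof induction
  case empty
  show ?case by (intro exI[of _ id]) (simp add: strict_mono_def)
next
  case (insert y X)
  then obtain r :: "nat \<Rightarrow> nat" where r: "strict_mono r" "\<forall>x\<in>X. mono (\<lambda>n. f (r n) x)" by blast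
  obtain q :: "nat \<Rightarrow> nat" where q: "strict_mono q" "mono (\<lambda>n. f (r (q n)) y)"
    using ex_mono_subseq_nat[of "\<lambda>n. f (r n) y"] by blast
  have "mono (\<lambda>n. f (r (q n)) x)" if "x \<in> X" for x
    using r(2) that strict_mono_mono[OF q(1)] by (simp add: mono_def)
  with q(2) have "\<forall>x\<in>insert y X. mono (\<lambda>n. f ((r \<circ> q) n) x)" by simp
  with strict_mono_o[OF r(1) q(1)] show ?case by blast
qed

text \<open>Multisets over \<open>X\<close> are vectors of multiplicities in finitely many
  coordinates. Along a subsequence monotone in each of them, any two terms are comparable, and an
  injective enumeration of \<open>S\<close> makes the inclusion proper.\<close>

lemma dickson_multiset:
  assumes "finite X" "infinite S" and sub: "\<And>M. M \<in> S \<Longrightarrow> set_mset M \<subseteq> X"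
  obtains M N where "M \<in> S" "N \<in> S" "M \<subset># N"
proof -
  obtain f :: "nat \<Rightarrow> 'a multiset" where f: "inj f" "range f \<subseteq> S"
    using infinite_countable_subset[OF assms(2)] by blast
  obtain r :: "nat \<Rightarrow> nat" where r: "strict_mono r" "\<forall>x\<in>X. mono (\<lambda>n. count (f (r n)) x)"
    using ex_mono_subseq_pointwise[OF assms(1), of "\<lambda>n. count (f n)"] by blast
  have "count (f (r 0)) x \<le> count (f (r 1)) x" for x
  proof (cases "x \<in> X")
    case True
    then show ?thesis using r(2) by (simp add: mono_def)
  next
    case False
    \<comment> \<open>Outside \<open>X\<close> the left-hand count is zero.\<close>
    then have "x \<notin># f (r 0)" using sub f(2) by blast
    then show ?thesis by (simp add: not_in_iff)
  qed
  then have "f (r 0) \<subseteq># f (r 1)" by (simp add: subseteq_mset_def)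
  moreover have "f (r 0) \<noteq> f (r 1)"
    using strict_monoD[OF r(1), of 0 1] by (simp add: inj_eq[OF f(1)])
  ultimately show ?thesis
    using that f(2) by (metis range_subsetD subset_mset.less_le)
qed

lemma finite_lists_mset_eq: "finite {w. mset w = M}"
proof (rule finite_subset)
  show "{w. mset w = M} \<subseteq> {w. set w \<subseteq> set_mset M \<and> length w = size M}" by auto
  show "finite {w. set w \<subseteq> set_mset M \<and> length w = size M}"
    by (intro finite_lists_length_eq) simp
qed

text \<open>The fibres of \<open>mset\<close> are finite, so infinitely many words give infinitely
  many multisets. Comparable multisets with equal sum \<open>A\<close> differ by a multiset of sum
  zero, by cancellation.\<close>

lemma ex_zero_sum_word:
  fixes A :: "'a::cancel_comm_monoid_add"
  assumes "finite X" and inf: "infinite {w \<in> lists X. sum_list w = A}"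
  obtains z where "z \<in> lists X" "z \<noteq> []" "sum_list z = 0"
proof -
  let ?P = "{w \<in> lists X. sum_list w = A}"
  have "infinite (mset ` ?P)"
  proof
    assume "finite (mset ` ?P)"
    then have "finite (\<Union>M\<in>mset ` ?P. {w. mset w = M})"
      using finite_lists_mset_eq by blast
    then have "finite ?P" by (rule rev_finite_subset) blast
    with inf show False ..
  qed
  moreover have "set_mset M \<subseteq> X" if "M \<in> mset ` ?P" for M using that by auto
  ultimately obtain M N where MN: "M \<in> mset ` ?P" "N \<in> mset ` ?P" "M \<subset># N"
    using dickson_multiset[OF assms(1)] by blast
  obtain z where z: "mset z = N - M" using ex_mset by blast
  have N: "N = M + mset z" using MN(3) z by (simp add: subset_mset.less_imp_le)
  have "sum_mset M = A" "sum_mset N = A" using MN(1,2) by (auto simp: sum_mset_sum_list)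
  then have "sum_list z = 0" using N by (simp add: sum_mset_sum_list)
  moreover have "z \<noteq> []" using N MN(3) by auto
  moreover have "set_mset N \<subseteq> X" using MN(2) by auto
  then have "z \<in> lists X" using N by auto
  ultimately show ?thesis using that by blast
qed

lemma infinite_words_of_zero_sum_word:
  fixes z u :: "'a::comm_monoid_add list"
  assumes z: "z \<in> lists X" "z \<noteq> []" "sum_list z = 0" and u: "u \<in> lists X"
  shows "infinite {w \<in> lists X. sum_list w = sum_list u}"
proof -
  let ?f = "\<lambda>n. concat (replicate n z) @ u"
  \<comment> \<open>Lengths tell the padded words apart, since \<open>z\<close> is nonempty.\<close>
  have "length (?f n) = n * length z + length u" for n
    by (simp add: length_concat sum_list_replicate)
  then have "m = n" if "?f m = ?f n" for m n using z(2) that by (metis add_right_cancel length_0_conv mult_right_cancel)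
  then have "inj ?f" by (rule injI)
  moreover have "sum_list (concat (replicate n z)) = 0" for n
    by (induction n) (simp_all add: z(3))
  then have "range ?f \<subseteq> {w \<in> lists X. sum_list w = sum_list u}"
    using z(1) u by (auto simp: in_lists_conv_set)
  ultimately show ?thesis using range_inj_infinite infinite_super by blast
qed

text \<open>Surjectivity of \<alpha>: it supplies, for each reachable point, a first word to which
  zero-sum loops can be prefixed.\<close>

lemma ex_word_additive_submonoid:
  assumes "A \<in> additive_submonoid X"
  shows "\<exists>w\<in>lists X. sum_list w = A"
  using assms
proof induction
  case zero
  show ?case by (intro bexI[of _ "[]"]) (simp_all add: zero_prod_def)
next
  case (gen A)
  then show ?case by (intro bexI[of _ "[A]"]) simp_all
next
  case (add A B)
  then obtain u v where "u \<in> lists X" "sum_list u = A" "v \<in> lists X" "sum_list v = B" by blast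
  then show ?case by (intro bexI[of _ "u @ v"]) simp_all
qed

lemma num_paths_infinity_iff:
  "num_paths X A = \<infinity> \<longleftrightarrow> infinite {w \<in> lists X. sum_list w = A}"
  by (simp add: num_paths_def paths_to_def free_monoid_def endpoint_def)

theorem corollary2p29:
  fixes X :: "(int \<times> int) set"
  assumes "step_set X" and "finite X"
  shows "FPP X \<or> IPP X"
\<comment> \<open>The criterion does not mention the endpoint \<open>A\<close>, which is why all
  points behave alike: a loop gives IPP, its absence FPP.\<close>
proof (cases "\<exists>z\<in>lists X. z \<noteq> [] \<and> sum_list z = 0")
  case True
  then obtain z where z: "z \<in> lists X" "z \<noteq> []" "sum_list z = 0" by blast
  have "num_paths X A = \<infinity>" if A: "A \<in> additive_submonoid X" for A
  proof -
    obtain u where "u \<in> lists X" "sum_list u = A"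
      using ex_word_additive_submonoid[OF A] by blast
    then show ?thesis
      using infinite_words_of_zero_sum_word[OF z, of u] by (simp add: num_paths_infinity_iff)
  qed
  then show ?thesis by (simp add: IPP_def)
next
  case False
  have "num_paths X A \<noteq> \<infinity>" for A
  proof
    assume "num_paths X A = \<infinity>"
    then have "infinite {w \<in> lists X. sum_list w = A}" using num_paths_infinity_iff by blast
    then obtain z where "z \<in> lists X" "z \<noteq> []" "sum_list z = 0"
      by (rule ex_zero_sum_word[OF assms(2)])
    with False show False by blast
  qed
  then show ?thesis by (simp add: FPP_def)
qed

end
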